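(* Let $\mathfrak a_{n,m,d}$ be the number of $\sigma\in\mathcal{I}_n(010)$ with $\max(\sigma)=m$ and exactly $d$ distinct values. Let $\mathfrak b_{n,k}$ be the number of words $\omega$ of length $n$ over $\{0,\dots,k-1\}$ avoiding $010$, in which every letter of $\{0,\dots,k-1\}$ appears at least once, and with $\omega_1=k-1$. Then for all integers $2\leqslant d\leqslant m+1\leqslant n$, $$\mathfrak a_{n,m,d}=\sum_{i=0}^{d-1}\binom{m-i}{d-i-1}\sum_{p=m+1}^{n}\mathfrak b_{n-p+1,d-i}\sum_{j=0}^{m-1}\mathfrak a_{p-1,j,i}.$$
   Context: For $n\in\mathbb N$, an inversion sequence of size $n$ is a sequence $\sigma=(\sigma_1,\dots,\sigma_n)\in\mathbb N^n$ with $\sigma_i<i$ for all $i$. An integer sequence contains a pattern $\rho$ (a finite integer sequence such as $010$) if it has a subsequence order-isomorphic to $\rho$, and avoids $\rho$ otherwise. $\mathcal{I}_n(P)$ denotes the set of inversion sequences of size $n$ avoiding every pattern in $P$. $\max(\sigma)$ is the largest entry of $\sigma$; for the empty sequence, $\max=-1$ and the number of distinct values is $0$. *)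

theory Defs
  imports Main "HOL-Library.Sublist"
begin

text \<open>
  Sequences are lists, so the entry written with (1-based) index \<open>i\<close> on paper is
  \<open>\<sigma> ! (i - 1)\<close>.
\<close>

definition order_isomorphic :: "'a::linorder list \<Rightarrow> 'b::linorder list \<Rightarrow> bool" where
  "order_isomorphic xs ys \<longleftrightarrow>
     length xs = length ys \<and>
     (\<forall>i < length xs. \<forall>j < length xs. xs ! i < xs ! j \<longleftrightarrow> ys ! i < ys ! j)"

definition contains_pattern :: "'a::linorder list \<Rightarrow> 'b::linorder list \<Rightarrow> bool" where
  "contains_pattern \<sigma> \<rho> \<longleftrightarrow> (\<exists>\<tau>. subseq \<tau> \<sigma> \<and> order_isomorphic \<tau> \<rho>)"

abbreviation avoids_pattern :: "'a::linorder list \<Rightarrow> 'b::linorder list \<Rightarrow> bool" where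
  "avoids_pattern \<sigma> \<rho> \<equiv> \<not> contains_pattern \<sigma> \<rho>"

text \<open>With 0-based indices the condition \<open>\<sigma>\<^sub>i < i\<close> becomes \<open>\<sigma> ! i < i + 1\<close>.\<close>

definition inversion_sequences :: "nat \<Rightarrow> nat list set" where
  "inversion_sequences n = {\<sigma>. length \<sigma> = n \<and> (\<forall>i < n. \<sigma> ! i < i + 1)}"

definition avoiding_inversion_sequences :: "nat \<Rightarrow> int list set \<Rightarrow> nat list set" where
  "avoiding_inversion_sequences n P =
     {\<sigma> \<in> inversion_sequences n. \<forall>\<rho> \<in> P. avoids_pattern \<sigma> \<rho>}"

definition max_entry :: "nat list \<Rightarrow> int" where
  "max_entry \<sigma> = (if \<sigma> = [] then - 1 else int (Max (set \<sigma>)))"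

definition num_a :: "nat \<Rightarrow> int \<Rightarrow> nat \<Rightarrow> nat" where
  "num_a n m d =
     card {\<sigma> \<in> avoiding_inversion_sequences n {[0, 1, 0]}.
             max_entry \<sigma> = m \<and> card (set \<sigma>) = d}"

text \<open>
  The equation for the first letter is stated over the integers, so that \<open>k - 1\<close> is not
  truncated for \<open>k = 0\<close>.
\<close>

definition num_b :: "nat \<Rightarrow> nat \<Rightarrow> nat" where
  "num_b n k =
     card {\<omega> :: nat list. length \<omega> = n \<and> set \<omega> = {0..<k} \<and>
             avoids_pattern \<omega> [0, 1, 0 :: int] \<and>
             \<omega> \<noteq> [] \<and> int (hd \<omega>) = int k - 1}"

end

theory Submission
  imports Defs
begin

text \<open>
  Cut \<open>\<sigma>\<close> just before the first occurrence of its maximum \<open>m\<close>, as \<open>\<sigma> = \<alpha> @ \<omega>\<close>. A value shared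
  by \<open>\<alpha>\<close> and \<open>\<omega>\<close> would form a 010 with that occurrence of \<open>m\<close>, so the values of \<open>\<omega>\<close> other than
  \<open>m\<close> are an arbitrary subset of those below \<open>m\<close> missed by \<open>\<alpha>\<close>. Conversely, if the two value
  sets are disjoint, every 010 in \<open>\<alpha> @ \<omega>\<close> lies within one of the two parts. The bound
  \<open>\<sigma>\<^sub>i < i\<close> is automatic on \<open>\<omega>\<close> once its first entry \<open>m\<close> satisfies it, and standardizing the
  values of \<open>\<omega>\<close> turns it into a word counted by \<open>num_b\<close>.
\<close>

section \<open>Occurrences of 010 under relabelling and concatenation\<close>

lemma contains_010_iff:
  fixes s :: "nat list"
  shows "contains_pattern s [0, 1, 0 :: int] \<longleftrightarrow> (\<exists>x y. x < y \<and> subseq [x, y, x] s)"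
proof -
  have "order_isomorphic t [0, 1, 0 :: int] \<longleftrightarrow> (\<exists>x y. x < y \<and> t = [x, y, x])" for t :: "nat list"
  proof
    assume iso: "order_isomorphic t [0, 1, 0 :: int]"
    then have "length t = 3" by (simp add: order_isomorphic_def)
    then obtain x y z where t: "t = [x, y, z]"
      by (auto simp: numeral_3_eq_3 length_Suc_conv)
    \<comment> \<open>Neither outer letter is below the other, so linearity of the order makes them
      equal.\<close>
    have "x < y" "\<not> x < z" "\<not> z < x"
      using iso by (simp_all add: t order_isomorphic_def All_less_Suc2)
    then show "\<exists>x y. x < y \<and> t = [x, y, x]" using t by (metis linorder_neqE)
  next
    assume "\<exists>x y. x < y \<and> t = [x, y, x]"
    then obtain x y where "x < y" "t = [x, y, x]" by blast
    then show "order_isomorphic t [0, 1, 0 :: int]"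
      by (simp add: order_isomorphic_def All_less_Suc2)
  qed
  then show ?thesis by (auto simp: contains_pattern_def)
qed

lemma subseq_imp_subset: "subseq s t \<Longrightarrow> set s \<subseteq> set t"
  by (rule subsetI, erule (1) list_emb_set) simp

text \<open>Lifts an occurrence of a pattern in a relabelled word to the positions it came
  from.\<close>

lemma subseq_map_preimage:
  assumes "subseq t (map f w)"
  obtains u where "subseq u w" "t = map f u"
proof -
  have "\<exists>u. subseq u w \<and> t = map f u"
    using assms
  proof (induction w arbitrary: t)
    case Nil
    then show ?case by auto
  next
    case (Cons a w)
    show ?case
    proof (cases "subseq t (map f w)")
      case True
      then obtain u where "subseq u w" "t = map f u" using Cons.IH by blast
      then have "subseq u (a # w) \<and> t = map f u" by (simp add: list_emb_Cons)
      then show ?thesis ..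
    next
      case False
      then obtain t' where "t = f a # t'" "subseq t' (map f w)"
        using Cons.prems by (cases t) (auto split: if_splits)
      then obtain u where "subseq u w" "t' = map f u" using Cons.IH by blast
      then have "subseq (a # u) (a # w) \<and> t = map f (a # u)" using \<open>t = f a # t'\<close> by simp
      then show ?thesis ..
    qed
  qed
  then show ?thesis using that by blast
qed

text \<open>A strictly increasing relabelling preserves and reflects both order and equality of
  letters, so occurrences transfer in both directions. Monotonicity is asked only on
  \<open>set w\<close>, because the enumeration of a finite set is increasing only on its range of
  indices.\<close>

lemma avoids_010_map_iff:
  fixes f :: "nat \<Rightarrow> nat"
  assumes mono: "strict_mono_on (set w) f"
  shows "avoids_pattern (map f w) [0, 1, 0 :: int] \<longleftrightarrow> avoids_pattern w [0, 1, 0 :: int]"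
proof -
  have "(\<exists>x y. x < y \<and> subseq [x, y, x] (map f w)) \<longleftrightarrow> (\<exists>x y. x < y \<and> subseq [x, y, x] w)"
  proof
    assume "\<exists>x y. x < y \<and> subseq [x, y, x] (map f w)"
    then obtain x y where xy: "x < y" "subseq [x, y, x] (map f w)" by blast
    then obtain u where u: "subseq u w" "[x, y, x] = map f u"
      by (elim subseq_map_preimage)
    then obtain a b c where abc: "u = [a, b, c]" "f a = x" "f b = y" "f c = x"
      by (auto simp: Cons_eq_map_conv)
    have sub: "{a, b, c} \<subseteq> set w" using subseq_imp_subset[OF u(1)] abc by simp
    have "a = c"
      using strict_mono_on_imp_inj_on[OF mono] sub abc by (auto dest: inj_onD)
    moreover have "a < b"
      using strict_mono_on_less[OF mono] sub abc xy(1) by auto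
    ultimately show "\<exists>x y. x < y \<and> subseq [x, y, x] w" using u abc by blast
  next
    assume "\<exists>x y. x < y \<and> subseq [x, y, x] w"
    then obtain x y where xy: "x < y" "subseq [x, y, x] w" by blast
    then have "{x, y} \<subseteq> set w" using subseq_imp_subset by fastforce
    then have "f x < f y" using strict_mono_onD[OF mono] xy(1) by auto
    moreover have "subseq [f x, f y, f x] (map f w)" using subseq_map[OF xy(2), of f] by simp
    ultimately show "\<exists>x y. x < y \<and> subseq [x, y, x] (map f w)" by blast
  qed
  then show ?thesis by (simp add: contains_010_iff)
qed

text \<open>The outer letters of 010 are equal, so disjoint value sets force both of them into the
  same factor, and the middle letter with them.\<close>

lemma avoids_010_append:
  fixes s t :: "nat list"
  assumes "set s \<inter> set t = {}"
    and "avoids_pattern s [0, 1, 0 :: int]" and "avoids_pattern t [0, 1, 0 :: int]"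
  shows "avoids_pattern (s @ t) [0, 1, 0 :: int]"
proof
  assume "contains_pattern (s @ t) [0, 1, 0 :: int]"
  then obtain x y where xy: "x < y" "subseq [x, y, x] (s @ t)"
    by (auto simp: contains_010_iff)
  then obtain u v where uv: "[x, y, x] = u @ v" "subseq u s" "subseq v t"
    by (meson subseq_appendE)
  have "set u \<inter> set v = {}"
    using assms(1) subseq_imp_subset[OF uv(2)] subseq_imp_subset[OF uv(3)] by blast
  \<comment> \<open>Every cut of \<open>[x, y, x]\<close> into two nonempty pieces leaves
    \<open>x\<close> in both.\<close>
  then have "u = [] \<or> v = []"
    using uv(1) by (auto simp: Cons_eq_append_conv)
  then show False
    using assms(2,3) uv xy(1) by (auto simp: contains_010_iff)
qed

lemma avoids_010_appendD:
  fixes s t :: "nat list"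
  assumes "avoids_pattern (s @ t) [0, 1, 0 :: int]"
  shows "avoids_pattern s [0, 1, 0 :: int]" and "avoids_pattern t [0, 1, 0 :: int]"
  using assms unfolding contains_010_iff
  by (meson subseq_rev_drop_many, meson list_emb_append2)

lemma avoids_010_disjoint:
  fixes s t :: "nat list"
  assumes "avoids_pattern (s @ m # t) [0, 1, 0 :: int]" and "\<forall>x \<in> set s. x < m"
  shows "set s \<inter> set (m # t) = {}"
proof -
  have "x \<notin> set t" if "x \<in> set s" for x
  proof
    assume "x \<in> set t"
    then have "subseq [m, x] (m # t)" by (simp add: subseq_singleton_left)
    moreover have "subseq [x] s" using that by (simp add: subseq_singleton_left)
    ultimately have "subseq ([x] @ [m, x]) (s @ m # t)" by (rule list_emb_append_mono[rotated])
    then show False using assms that by (auto simp: contains_010_iff)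
  qed
  then show ?thesis using assms(2) by auto
qed

section \<open>Words that start with their largest letter, and their standardization\<close>

definition topped_words :: "nat \<Rightarrow> nat set \<Rightarrow> nat list set" where
  "topped_words n V =
     {w. length w = n \<and> set w = V \<and> avoids_pattern w [0, 1, 0 :: int] \<and> hd w = Max V}"

lemma finite_topped_words: "finite V \<Longrightarrow> finite (topped_words n V)"
  by (rule finite_subset[OF _ finite_lists_length_eq[of V n]]) (auto simp: topped_words_def)

text \<open>Replacing each letter by its rank in \<open>V\<close> preserves 010-avoidance and sends
  the top letter to \<open>card V - 1\<close>, so only the size of \<open>V\<close> matters.\<close>

lemma card_topped_words:
  assumes "finite V" "V \<noteq> {}"
  shows "card (topped_words n V) = num_b n (card V)"
proof -
  define k where "k = card V"
  \<comment> \<open>The increasing enumeration of \<open>V\<close>, counted from 0; applying it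
    letterwise undoes standardization.\<close>
  define f where "f = (\<lambda>i. sorted_list_of_set V ! i)"
  have k: "k > 0" using assms by (simp add: k_def card_gt_0_iff)
  have mono: "strict_mono_on {0..<k} f"
    using strict_sorted_list_of_set[of V]
    by (auto simp: strict_mono_on_def f_def k_def sorted_wrt_iff_nth_less)
  have img: "f ` {0..<k} = V"
  proof -
    have "f ` {0..<k} = set (sorted_list_of_set V)"
      by (force simp: f_def k_def set_conv_nth)
    then show ?thesis using assms by simp
  qed
  have inj: "inj_on f {0..<k}" using mono by (rule strict_mono_on_imp_inj_on)
  have Max: "Max V = f (k - 1)"
  proof (rule Max_eqI)
    fix y assume "y \<in> V"
    then obtain i where "i < k" "y = f i" using img by auto
    then show "y \<le> f (k - 1)"
      using strict_mono_on_leD[OF mono, of i "k - 1"] k by auto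
  qed (use assms img k in auto)
  define B where "B = {w :: nat list. length w = n \<and> set w = {0..<k} \<and>
             avoids_pattern w [0, 1, 0 :: int] \<and> w \<noteq> [] \<and> int (hd w) = int k - 1}"
  have "bij_betw (map f) B (topped_words n V)"
    unfolding bij_betw_def
  proof
    show "inj_on (map f) B"
      by (rule inj_on_subset[OF inj_on_mapI[of f B]]) (auto simp: B_def inj)
    show "map f ` B = topped_words n V"
    proof (intro equalityI subsetI)
      fix w assume "w \<in> map f ` B"
      then obtain u where u: "w = map f u" "length u = n" "set u = {0..<k}"
        "avoids_pattern u [0, 1, 0 :: int]" "u \<noteq> []" "int (hd u) = int k - 1"
        by (auto simp: B_def)
      then have "hd u = k - 1" by linarith
      then show "w \<in> topped_words n V"
        using u img mono Max avoids_010_map_iff[of u f]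
        by (simp add: topped_words_def hd_map)
    next
      fix w assume "w \<in> topped_words n V"
      then have w: "length w = n" "set w = V" "avoids_pattern w [0, 1, 0 :: int]" "hd w = Max V"
        by (auto simp: topped_words_def)
      \<comment> \<open>The standardization of \<open>w\<close>: each letter becomes its rank in
        \<open>V\<close>.\<close>
      define u where "u = map (inv_into {0..<k} f) w"
      have fu: "map f u = w"
        unfolding u_def map_map using w(2) img by (intro map_idI) (auto intro: f_inv_into_f)
      have su: "set u = {0..<k}"
        using w(2) img inv_into_image_cancel[OF inj subset_refl] by (simp add: u_def)
      \<comment> \<open>Nonemptiness, which gives \<open>hd\<close> its meaning, comes from
        \<open>k > 0\<close>.\<close>
      have ne: "u \<noteq> []" using su k by auto
      then have "f (hd u) = f (k - 1)" using fu w(4) Max by (metis hd_map)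
      moreover have "hd u \<in> {0..<k}" using ne su hd_in_set by blast
      ultimately have "hd u = k - 1" using inj k by (auto dest: inj_onD)
      moreover have "avoids_pattern u [0, 1, 0 :: int]"
        using avoids_010_map_iff[of u f] mono su fu w(3) by simp
      ultimately have "u \<in> B"
        using w(1) fu su ne k by (auto simp: B_def)
      then show "w \<in> map f ` B" using fu by blast
    qed
  qed
  then have "card B = card (topped_words n V)" by (rule bij_betw_same_card)
  then show ?thesis by (simp add: num_b_def B_def k_def)
qed

section \<open>Prefixes before the first maximum, sorted by length, maximum and number of
  values\<close>

lemma finite_avoiding_inversion_sequences: "finite (avoiding_inversion_sequences n P)"
proof (rule finite_subset[OF _ finite_lists_length_eq[of "{..<n}" n]])
  have "x < n" if "\<forall>i < n. s ! i < i + 1" "length s = n" "x \<in> set s" for s :: "nat list" and x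
    using that by (metis Suc_eq_plus1 in_set_conv_nth less_Suc_eq_le order.strict_trans1)
  then show "avoiding_inversion_sequences n P \<subseteq> {xs. set xs \<subseteq> {..<n} \<and> length xs = n}"
    by (auto simp: avoiding_inversion_sequences_def inversion_sequences_def)
qed simp

lemma max_entry_eq_iff:
  "max_entry s = int m \<longleftrightarrow> m \<in> set s \<and> (\<forall>x \<in> set s. x \<le> m)"
  by (auto simp: max_entry_def Max_eq_iff)

text \<open>The candidates for what precedes the first \<open>m\<close>. That \<open>m\<close> has
  0-based index \<open>length a\<close>, so the inversion bound at it reads
  \<open>m \<le> length a\<close>; \<open>card (set a) < d\<close> leaves room for \<open>m\<close>
  as a further value.\<close>

definition prefixes_below :: "nat \<Rightarrow> nat \<Rightarrow> nat \<Rightarrow> nat list set" where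
  "prefixes_below n m d =
     {a. m \<le> length a \<and> length a < n \<and>
         a \<in> avoiding_inversion_sequences (length a) {[0, 1, 0]} \<and>
         (\<forall>x \<in> set a. x < m) \<and> card (set a) < d}"

text \<open>The set behind \<open>num_a\<close> for a natural maximum, which excludes the empty
  sequence with its maximum -1.\<close>

definition inv_seqs_010 :: "nat \<Rightarrow> nat \<Rightarrow> nat \<Rightarrow> nat list set" where
  "inv_seqs_010 n m d =
     {s \<in> avoiding_inversion_sequences n {[0, 1, 0]}. max_entry s = int m \<and> card (set s) = d}"

lemma finite_inv_seqs_010: "finite (inv_seqs_010 n m d)"
  by (simp add: inv_seqs_010_def finite_avoiding_inversion_sequences)

text \<open>Since \<open>0 < m \<le> length a\<close>, a prefix is nonempty and has a natural
  maximum \<open>j \<le> m - 1\<close>. The index \<open>p\<close> is the 1-based position of the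
  first \<open>m\<close>, so the prefix has length \<open>p - 1\<close>.\<close>

lemma prefixes_below_eq_UN:
  assumes "0 < d" "0 < m"
  shows "prefixes_below n m d =
    (\<Union>(i, p, j) \<in> {0..d - 1} \<times> {m + 1..n} \<times> {0..m - 1}. inv_seqs_010 (p - 1) j i)"
proof (intro equalityI subsetI)
  fix a assume a: "a \<in> prefixes_below n m d"
  then have ne: "a \<noteq> []" using assms by (auto simp: prefixes_below_def)
  have M: "Max (set a) < m" "max_entry a = int (Max (set a))"
    using a ne by (auto simp: prefixes_below_def max_entry_def)
  have "a \<in> inv_seqs_010 (Suc (length a) - 1) (Max (set a)) (card (set a))"
    using a M by (simp add: inv_seqs_010_def prefixes_below_def)
  moreover have "(card (set a), Suc (length a), Max (set a)) \<in> {0..d - 1} \<times> {m + 1..n} \<times> {0..m - 1}"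
    using a M by (auto simp: prefixes_below_def)
  ultimately show "a \<in> (\<Union>(i, p, j) \<in> {0..d - 1} \<times> {m + 1..n} \<times> {0..m - 1}. inv_seqs_010 (p - 1) j i)"
    by blast
next
  fix a assume "a \<in> (\<Union>(i, p, j) \<in> {0..d - 1} \<times> {m + 1..n} \<times> {0..m - 1}. inv_seqs_010 (p - 1) j i)"
  then obtain i p j where h: "i \<le> d - 1" "m + 1 \<le> p" "p \<le> n" "j \<le> m - 1" "a \<in> inv_seqs_010 (p - 1) j i"
    by auto
  then have "length a = p - 1"
    by (auto simp: inv_seqs_010_def avoiding_inversion_sequences_def inversion_sequences_def)
  then show "a \<in> prefixes_below n m d"
    using h assms by (force simp: inv_seqs_010_def prefixes_below_def max_entry_eq_iff)
qed

lemma inv_seqs_010_disjoint: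
  assumes "a \<in> inv_seqs_010 n m d" "a \<in> inv_seqs_010 n' m' d'"
  shows "n = n' \<and> m = m' \<and> d = d'"
  using assms
  by (auto simp: inv_seqs_010_def avoiding_inversion_sequences_def inversion_sequences_def)

text \<open>A sequence determines its length, maximum and number of values, so the classes are
  disjoint; the summand is constant on each class, whose size is a value of
  \<open>num_a\<close>.\<close>

lemma sum_prefixes_below:
  fixes g :: "nat \<Rightarrow> nat \<Rightarrow> nat"
  assumes "0 < d" "0 < m"
  shows "(\<Sum>a \<in> prefixes_below n m d. g (card (set a)) (length a)) =
    (\<Sum>i = 0..d - 1. \<Sum>p = m + 1..n. \<Sum>j = 0..m - 1. g i (p - 1) * num_a (p - 1) (int j) i)"
proof -
  let ?I = "{0..d - 1} \<times> {m + 1..n} \<times> {0..m - 1}"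
  let ?A = "\<lambda>(i, p, j). inv_seqs_010 (p - 1) j i"
  have "(\<Sum>a \<in> prefixes_below n m d. g (card (set a)) (length a)) =
      (\<Sum>x \<in> ?I. \<Sum>a \<in> ?A x. g (card (set a)) (length a))"
    unfolding prefixes_below_eq_UN[OF assms]
  proof (rule sum.UNION_disjoint)
    show "\<forall>x \<in> ?I. \<forall>y \<in> ?I. x \<noteq> y \<longrightarrow> ?A x \<inter> ?A y = {}"
    proof clarsimp
      fix i p j i' p' j' :: nat
      \<comment> \<open>Both positions are at least 1, so equal lengths \<open>p - 1\<close> and
        \<open>p' - 1\<close> give equal positions.\<close>
      assume p: "Suc m \<le> p" "Suc m \<le> p'"
        and ne: "i = i' \<longrightarrow> p = p' \<longrightarrow> j \<noteq> j'"
      show "inv_seqs_010 (p - Suc 0) j i \<inter> inv_seqs_010 (p' - Suc 0) j' i' = {}"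
        using inv_seqs_010_disjoint p ne by fastforce
    qed
  qed (auto simp: finite_inv_seqs_010)
  also have "\<dots> = (\<Sum>(i, p, j) \<in> ?I. g i (p - 1) * num_a (p - 1) (int j) i)"
  proof (rule sum.cong[OF refl])
    fix x assume "x \<in> ?I"
    obtain i p j where x: "x = (i, p, j)" by (cases x)
    have "(\<Sum>a \<in> inv_seqs_010 (p - 1) j i. g (card (set a)) (length a)) =
        (\<Sum>a \<in> inv_seqs_010 (p - 1) j i. g i (p - 1))"
      by (rule sum.cong) (auto simp: inv_seqs_010_def avoiding_inversion_sequences_def
        inversion_sequences_def)
    then show "(\<Sum>a \<in> ?A x. g (card (set a)) (length a)) =
        (case x of (i, p, j) \<Rightarrow> g i (p - 1) * num_a (p - 1) (int j) i)"
      by (simp add: x num_a_def inv_seqs_010_def)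
  qed
  also have "\<dots> = (\<Sum>i = 0..d - 1. \<Sum>p = m + 1..n. \<Sum>j = 0..m - 1.
      g i (p - 1) * num_a (p - 1) (int j) i)"
    by (simp add: sum.cartesian_product)
  finally show ?thesis .
qed

section \<open>Cutting and gluing at the first maximum\<close>

definition free_values :: "nat \<Rightarrow> nat \<Rightarrow> nat list \<Rightarrow> nat set set" where
  "free_values m d a = {V. V \<subseteq> {..<m} - set a \<and> card V = d - card (set a) - 1}"

lemma finite_free_values: "finite (free_values m d a)"
  by (rule finite_subset[of _ "Pow {..<m}"]) (auto simp: free_values_def)

text \<open>\<open>V\<close> stands for the values of the suffix other than \<open>m\<close>. The
  prefix occupies \<open>card (set a)\<close> of the \<open>m\<close> values below \<open>m\<close>;
  of the \<open>d\<close> values in total, those of the prefix and \<open>m\<close> itself are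
  already accounted for.\<close>

lemma card_free_values:
  assumes "\<forall>x \<in> set a. x < m"
  shows "card (free_values m d a) = (m - card (set a)) choose (d - card (set a) - 1)"
proof -
  have "card ({..<m} - set a) = m - card (set a)"
    using assms by (subst card_Diff_subset) auto
  then show ?thesis by (simp add: free_values_def n_subsets)
qed

lemma append_mem_inv_seqs_010:
  assumes a: "a \<in> prefixes_below n m d" and V: "V \<in> free_values m d a"
    and w: "w \<in> topped_words (n - length a) (insert m V)"
  shows "a @ w \<in> inv_seqs_010 n m d"
proof -
  have A: "m \<le> length a" "length a < n" "\<forall>i < length a. a ! i < i + 1"
    "avoids_pattern a [0, 1, 0 :: int]" "\<forall>x \<in> set a. x < m" "card (set a) < d"
    using a by (auto simp: prefixes_below_def avoiding_inversion_sequences_def inversion_sequences_def)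
  have V': "V \<subseteq> {..<m} - set a" "card V = d - card (set a) - 1"
    using V by (auto simp: free_values_def)
  have finV: "finite V" using V'(1) finite_subset by blast
  have W: "length w = n - length a" "set w = insert m V" "avoids_pattern w [0, 1, 0 :: int]"
    using w by (auto simp: topped_words_def)
  have disj: "set a \<inter> set w = {}" using A(5) V'(1) W(2) by auto
  have le: "\<forall>x \<in> set w. x \<le> m" using V'(1) W(2) by auto
  have "(a @ w) ! i < i + 1" if "i < n" for i
  proof (cases "i < length a")
    case True
    then show ?thesis using A(3) by (simp add: nth_append)
  next
    case False
    \<comment> \<open>Every suffix entry is at most \<open>m \<le> length a \<le> i\<close>, which
      is the inversion bound.\<close>
    then have "w ! (i - length a) \<in> set w" using W(1) that A(2) by auto
    then have "w ! (i - length a) \<le> m" using le by blast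
    then show ?thesis using False A(1) by (simp add: nth_append)
  qed
  moreover have "card (set (a @ w)) = d"
  proof -
    have "card (set w) = Suc (card V)" unfolding W(2) using V'(1) finV by (subst card_insert_disjoint) auto
    then show ?thesis using V'(2) A(6) disj by (simp add: card_Un_disjoint)
  qed
  moreover have "max_entry (a @ w) = int m"
    using A(5) W(2) le by (auto simp: max_entry_eq_iff)
  ultimately show ?thesis
    using avoids_010_append[OF disj A(4) W(3)] A(2) W(1)
    by (simp add: inv_seqs_010_def avoiding_inversion_sequences_def inversion_sequences_def)
qed

lemma inv_seqs_010_split:
  assumes "s \<in> inv_seqs_010 n m d"
  obtains a V w where "a \<in> prefixes_below n m d" "V \<in> free_values m d a"
    "w \<in> topped_words (n - length a) (insert m V)" "s = a @ w"
proof -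
  have S: "length s = n" "\<And>i. i < n \<Longrightarrow> s ! i < i + 1" "avoids_pattern s [0, 1, 0 :: int]"
    "m \<in> set s" "\<forall>x \<in> set s. x \<le> m" "card (set s) = d"
    using assms by (auto simp: inv_seqs_010_def avoiding_inversion_sequences_def
        inversion_sequences_def max_entry_eq_iff)
  \<comment> \<open>The cut is made at the first \<open>m\<close>, so all entries of
    \<open>a\<close> lie strictly below \<open>m\<close>.\<close>
  obtain a t where s: "s = a @ m # t" "m \<notin> set a"
    using S(4) by (meson split_list_first)
  define V where "V = set t - {m}"
  have lt: "\<forall>x \<in> set a. x < m"
    using S(5) s by (metis Un_iff le_neq_implies_less set_append)
  have disj: "set a \<inter> set (m # t) = {}"
    using avoids_010_disjoint S(3) lt unfolding s by blast
  have setw: "set (m # t) = insert m V" by (auto simp: V_def)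
  have len: "length a < n" using S(1) s by auto
  \<comment> \<open>This is the inversion bound at the first \<open>m\<close> itself.\<close>
  have "m \<le> length a" using S(2)[OF len] s by simp
  \<comment> \<open>Disjointness makes the value counts add up. The additive form keeps the later
    \<open>d - card (set a) - 1\<close> free of truncation.\<close>
  have card: "d = card (set a) + Suc (card V)"
  proof -
    have "card (set (m # t)) = Suc (card V)" unfolding setw by (subst card_insert_disjoint) (auto simp: V_def)
    then show ?thesis
      using S(6) card_Un_disjoint[OF _ _ disj] unfolding s(1) set_append by simp
  qed
  have "a ! i < i + 1" if "i < length a" for i
    using S(2)[of i] that len by (simp add: s nth_append)
  then have "a \<in> prefixes_below n m d"
    using \<open>m \<le> length a\<close> len lt card avoids_010_appendD(1)[OF S(3)[unfolded s(1)]]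
    by (auto simp: prefixes_below_def avoiding_inversion_sequences_def inversion_sequences_def)
  moreover have "V \<in> free_values m d a"
  proof -
    have "V \<subseteq> {..<m}" using S(5) s by (force simp: V_def)
    then show ?thesis using disj card by (auto simp: free_values_def V_def)
  qed
  moreover have "m # t \<in> topped_words (n - length a) (insert m V)"
  proof -
    have "Max (insert m V) = m"
      by (rule Max_eqI) (use S(5) s in \<open>auto simp: V_def\<close>)
    moreover have "avoids_pattern (m # t) [0, 1, 0 :: int]"
      using avoids_010_appendD(2)[OF S(3)[unfolded s(1)]] .
    ultimately show ?thesis using S(1) s setw by (simp add: topped_words_def)
  qed
  ultimately show ?thesis using that s(1) by blast
qed

text \<open>The suffix begins with \<open>m\<close> and the prefix stays below it, so the prefix is
  recovered as the longest initial run of entries below \<open>m\<close>; then \<open>V\<close> is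
  the value set of the suffix without \<open>m\<close>.\<close>

lemma append_topped_word_inject:
  assumes "a \<in> prefixes_below n m d" "V \<in> free_values m d a"
    "w \<in> topped_words (n - length a) (insert m V)"
    and "a' \<in> prefixes_below n m d" "V' \<in> free_values m d a'"
    "w' \<in> topped_words (n - length a') (insert m V')"
    and eq: "a @ w = a' @ w'"
  shows "a = a' \<and> V = V' \<and> w = w'"
proof -
  have prefix: "takeWhile (\<lambda>x. x < m) (b @ u) = b \<and> U = set u - {m}"
    if b: "b \<in> prefixes_below n m d" and U: "U \<in> free_values m d b"
      and u: "u \<in> topped_words (n - length b) (insert m U)" for b u U
  proof -
    have Um: "U \<subseteq> {..<m}" using U by (auto simp: free_values_def)
    have "Max (insert m U) = m"
      by (rule Max_eqI) (use Um finite_subset[OF Um] in auto)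
    then have "hd u = m" "set u = insert m U" using u by (auto simp: topped_words_def)
    moreover from this have "u = m # tl u" by (cases u) auto
    ultimately have "takeWhile (\<lambda>x. x < m) u = []" by (metis less_irrefl takeWhile.simps(2))
    then show ?thesis
      using b Um \<open>set u = insert m U\<close> by (auto simp: prefixes_below_def takeWhile_append)
  qed
  have "a = a'" using prefix assms by metis
  moreover from this have "w = w'" using eq by simp
  ultimately show ?thesis using prefix assms by metis
qed

text \<open>For a fixed prefix the binomial coefficient counts the sets \<open>V\<close>, and
  \<open>num_b\<close> counts the suffixes for each \<open>V\<close>, a number depending on
  \<open>V\<close> only through its size.\<close>

lemma card_inv_seqs_010:
  "card (inv_seqs_010 n m d) =
    (\<Sum>a \<in> prefixes_below n m d.
      ((m - card (set a)) choose (d - card (set a) - 1)) * num_b (n - length a) (d - card (set a)))"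
proof -
  let ?P = "prefixes_below n m d"
  let ?W = "\<lambda>a V. topped_words (n - length a) (insert m V)"
  let ?T = "SIGMA a : ?P. SIGMA V : free_values m d a. ?W a V"
  have "bij_betw (\<lambda>(a, V, w). a @ w) ?T (inv_seqs_010 n m d)"
    unfolding bij_betw_def
  proof
    show "inj_on (\<lambda>(a, V, w). a @ w) ?T"
      by (rule inj_onI) (clarsimp, metis append_topped_word_inject)
    show "(\<lambda>(a, V, w). a @ w) ` ?T = inv_seqs_010 n m d"
    proof (intro equalityI subsetI)
      fix s assume "s \<in> inv_seqs_010 n m d"
      then show "s \<in> (\<lambda>(a, V, w). a @ w) ` ?T"
        by (elim inv_seqs_010_split) force
    qed (auto intro: append_mem_inv_seqs_010)
  qed
  then have "card (inv_seqs_010 n m d) = card ?T" by (simp add: bij_betw_same_card)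
  also have "\<dots> = (\<Sum>a \<in> ?P. \<Sum>V \<in> free_values m d a. card (?W a V))"
  proof -
    have finP: "finite ?P"
      by (rule finite_subset[of _ "\<Union>l < n. avoiding_inversion_sequences l {[0, 1, 0]}"])
        (auto simp: prefixes_below_def finite_avoiding_inversion_sequences)
    have finW: "finite (?W a V)" if "V \<in> free_values m d a" for a V
      using that finite_subset[of V "{..<m}"]
      by (auto simp: free_values_def intro!: finite_topped_words)
    have "card (SIGMA V : free_values m d a. ?W a V) = (\<Sum>V \<in> free_values m d a. card (?W a V))" for a
      by (rule card_SigmaI) (auto simp: finite_free_values finW)
    then show ?thesis
      by (subst card_SigmaI) (auto simp: finP finite_free_values finW intro!: finite_SigmaI)
  qed
  also have "\<dots> = (\<Sum>a \<in> ?P. ((m - card (set a)) choose (d - card (set a) - 1)) *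
      num_b (n - length a) (d - card (set a)))"
  proof (rule sum.cong[OF refl])
    fix a assume a: "a \<in> ?P"
    have "card (?W a V) = num_b (n - length a) (d - card (set a))" if V: "V \<in> free_values m d a" for V
    proof -
      have "V \<subseteq> {..<m}" "card V = d - card (set a) - 1" using V by (auto simp: free_values_def)
      moreover from this have "finite V" "m \<notin> V" using finite_subset by blast+
      \<comment> \<open>This rules out truncation, so \<open>insert m V\<close> has exactly
        \<open>d - card (set a)\<close> elements.\<close>
      moreover have "card (set a) < d" using a by (simp add: prefixes_below_def)
      ultimately show ?thesis by (simp add: card_topped_words Suc_diff_Suc)
    qed
    then show "(\<Sum>V \<in> free_values m d a. card (?W a V)) =
        ((m - card (set a)) choose (d - card (set a) - 1)) * num_b (n - length a) (d - card (set a))"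
      using a by (simp add: card_free_values prefixes_below_def)
  qed
  finally show ?thesis .
qed

section \<open>Rearranging the count over prefixes into the triple sum\<close>

theorem theorem18:
  fixes n m d :: nat
  assumes "2 \<le> d" and "d \<le> m + 1" and "m + 1 \<le> n"
  shows "num_a n (int m) d =
    (\<Sum>i = 0..d - 1. ((m - i) choose (d - i - 1)) *
      (\<Sum>p = m + 1..n. num_b (n - p + 1) (d - i) *
        (\<Sum>j = 0..m - 1. num_a (p - 1) (int j) i)))"
proof -
  have "num_a n (int m) d = card (inv_seqs_010 n m d)"
    by (simp add: num_a_def inv_seqs_010_def)
  \<comment> \<open>From \<open>2 \<le> d\<close> and \<open>d \<le> m + 1\<close>, both
    \<open>d\<close> and \<open>m\<close> are positive, as the sum over prefixes requires.\<close>
  also have "\<dots> = (\<Sum>i = 0..d - 1. \<Sum>p = m + 1..n. \<Sum>j = 0..m - 1.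
      ((m - i) choose (d - i - 1)) * num_b (n - (p - 1)) (d - i) * num_a (p - 1) (int j) i)"
    unfolding card_inv_seqs_010
    using assms sum_prefixes_below[of d m "\<lambda>i l. ((m - i) choose (d - i - 1)) * num_b (n - l) (d - i)"]
    by simp
  also have "\<dots> = (\<Sum>i = 0..d - 1. \<Sum>p = m + 1..n. \<Sum>j = 0..m - 1.
      ((m - i) choose (d - i - 1)) * num_b (n - p + 1) (d - i) * num_a (p - 1) (int j) i)"
  proof (intro sum.cong refl)
    fix i p j assume "p \<in> {m + 1..n}"
    \<comment> \<open>As \<open>1 \<le> p \<le> n\<close>, no subtraction is truncated: a suffix
      starting at 1-based position \<open>p\<close> has \<open>n - p + 1\<close> letters.\<close>
    then have "n - (p - 1) = n - p + 1" by auto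
    then show "((m - i) choose (d - i - 1)) * num_b (n - (p - 1)) (d - i) * num_a (p - 1) (int j) i =
        ((m - i) choose (d - i - 1)) * num_b (n - p + 1) (d - i) * num_a (p - 1) (int j) i"
      by simp
  qed
  finally show ?thesis
    by (simp add: sum_distrib_left mult.assoc)
qed

end
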